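(* Let $H$ be a complex Hilbert space with $\dim(H)\ge 2$, let $\mathbf{G}\subseteq H$ be non-empty, and let $\Theta=\{\theta_1,\theta_2,\theta_3\}\subseteq\mathbb{T}$ with $\theta_1,\theta_2,\theta_3$ pairwise distinct. Then $\mathbf{G}$ fails $\Theta$-PR if and only if there exist $\mathbf{G}_1,\mathbf{G}_2,\mathbf{G}_3\subseteq\mathbf{G}$ with $\mathbf{G}_1\cup\mathbf{G}_2\cup\mathbf{G}_3=\mathbf{G}$ and $x_1,x_2,x_3\in H$ such that: 1. $0\neq x_j\in\mathbf{G}_j^\perp$ for $j=1,2,3$; 2. $x_1$ and $x_2$ are linearly independent; 3. $x_3\in\mathrm{span}\{x_1,x_2\}$.
   Context: $\mathbb{T}=\{z\in\mathbb{C}:|z|=1\}$. The inner product $\langle\cdot,\cdot\rangle$ is linear in the first and conjugate linear in the second argument. $X^\perp$ is the orthogonal complement of $X\subseteq H$. For $\Theta\subseteq\mathbb{T}$, a set $\mathbf{G}\subseteq H$ does $\Theta$-PR (in $H$) if for all $f,h\in H$ the following holds: if for every $g\in\mathbf{G}$ there exists $\theta_g\in\Theta$ with $\langle f,g\rangle=\theta_g\langle h,g\rangle$, then $f=\theta h$ for some $\theta\in\Theta$. $\mathbf{G}$ fails $\Theta$-PR if it does not do $\Theta$-PR. *)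

theory Defs
  imports "HOL-Analysis.Analysis"
begin

class complex_vector = real_vector +
  fixes scaleC :: "complex \<Rightarrow> 'a \<Rightarrow> 'a" (infixr "*\<^sub>C" 75)
  assumes scaleC_add_right: "a *\<^sub>C (x + y) = a *\<^sub>C x + a *\<^sub>C y"
    and scaleC_add_left: "(a + b) *\<^sub>C x = a *\<^sub>C x + b *\<^sub>C x"
    and scaleC_scaleC: "a *\<^sub>C (b *\<^sub>C x) = (a * b) *\<^sub>C x"
    and scaleC_one: "1 *\<^sub>C x = x"
    and scaleR_scaleC: "r *\<^sub>R x = complex_of_real r *\<^sub>C x"

global_interpretation complex_vector: vector_space "scaleC :: complex \<Rightarrow> 'a \<Rightarrow> 'a::complex_vector"
  defines cdependent_raw_def: cdependent = complex_vector.dependent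
    and cspan_raw_def: cspan = complex_vector.span
    and cdim_raw_def: cdim = complex_vector.dim
  by unfold_locales
    (simp_all add: scaleC_add_right scaleC_add_left scaleC_scaleC scaleC_one)

abbreviation cindependent :: "'a::complex_vector set \<Rightarrow> bool"
  where "cindependent S \<equiv> \<not> cdependent S"

(* Linear in the first argument, conjugate linear in the second.
   Through real_normed_vector the metric and the topology are those of the norm. *)
class complex_inner = complex_vector + real_normed_vector +
  fixes cinner :: "'a \<Rightarrow> 'a \<Rightarrow> complex"
  assumes cinner_commute: "cinner x y = cnj (cinner y x)"
    and cinner_add_left: "cinner (x + y) z = cinner x z + cinner y z"
    and cinner_scaleC_left: "cinner (a *\<^sub>C x) y = a * cinner x y"
    and cinner_self_nonneg: "0 \<le> Re (cinner x x)"
    and cinner_self_eq_zero_iff: "cinner x x = 0 \<longleftrightarrow> x = 0"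
    and norm_eq_sqrt_cinner: "norm x = sqrt (Re (cinner x x))"

class complex_hilbert_space = complex_inner + complete_space

definition orth_compl :: "'a::complex_inner set \<Rightarrow> 'a set"
  where "orth_compl X = {f. \<forall>g\<in>X. cinner f g = 0}"

definition does_PR :: "complex set \<Rightarrow> 'a::complex_inner set \<Rightarrow> bool"
  where "does_PR \<Theta> G \<longleftrightarrow>
    (\<forall>f h. (\<forall>g\<in>G. \<exists>\<theta>\<in>\<Theta>. cinner f g = \<theta> * cinner h g) \<longrightarrow> (\<exists>\<theta>\<in>\<Theta>. f = \<theta> *\<^sub>C h))"

(* cdim UNIV is 0 when the space is infinite-dimensional, so the library dimension
   is only consulted for spaces spanned by a finite set. *)
definition cdim_at_least :: "nat \<Rightarrow> 'a::complex_vector itself \<Rightarrow> bool"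
  where "cdim_at_least n _ \<longleftrightarrow>
    ((\<exists>B::'a set. finite B \<and> cspan B = UNIV) \<longrightarrow> n \<le> cdim (UNIV :: 'a set))"

(* Independence of the family (x, y): the set {x, y} alone would collapse for x = y. *)
definition lin_indep_pair :: "'a::complex_vector \<Rightarrow> 'a \<Rightarrow> bool"
  where "lin_indep_pair x y \<longleftrightarrow> x \<noteq> y \<and> cindependent {x, y}"

end

theory Submission
  imports Defs
begin

text \<open>With \<open>y\<^sub>j = f - \<theta>\<^sub>j h\<close>, a pair \<open>(f, h)\<close> witnesses the failure of PR iff all \<open>y\<^sub>j\<close> are nonzero
  and every vector of \<open>G\<close> is orthogonal to one of them. The \<open>y\<^sub>j\<close> lie on a complex line, so
  they satisfy \<open>(\<theta>\<^sub>2 - \<theta>\<^sub>1) y\<^sub>3 = (\<theta>\<^sub>2 - \<theta>\<^sub>3) y\<^sub>1 + (\<theta>\<^sub>3 - \<theta>\<^sub>1) y\<^sub>2\<close>; conversely, nonzero vectors with this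
  relation come from such a pair. Rescaling \<open>x\<^sub>1\<close> and \<open>x\<^sub>2\<close> gives the relation as soon as
  \<open>x\<^sub>3 = a x\<^sub>1 + b x\<^sub>2\<close> with \<open>a, b \<noteq> 0\<close>. If \<open>x\<^sub>3\<close> is parallel to \<open>x\<^sub>1\<close> or \<open>x\<^sub>2\<close>, two sets suffice and \<open>x\<^sub>3\<close> may
  be replaced by \<open>x\<^sub>1 + x\<^sub>2\<close>. If the \<open>y\<^sub>j\<close> are all parallel, then \<open>y\<^sub>1\<close> is orthogonal to \<open>G\<close>.\<close>

lemma cinner_diff_left: "cinner (x - y) z = cinner x z - cinner (y::'a::complex_inner) z"
  using cinner_add_left[of "x - y" y z] by simp

text \<open>By linearity in the first argument, the equation for each \<open>g\<close> and the
  equation in the whole space both become statements about the single vector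
  \<open>f - \<theta> *\<^sub>C h\<close>.\<close>

lemma not_does_PR_iff:
  fixes G :: "'a::complex_inner set"
  shows "\<not> does_PR \<Theta> G \<longleftrightarrow>
    (\<exists>f h. (\<forall>\<theta>\<in>\<Theta>. f - \<theta> *\<^sub>C h \<noteq> 0) \<and> (\<forall>g\<in>G. \<exists>\<theta>\<in>\<Theta>. cinner (f - \<theta> *\<^sub>C h) g = 0))"
  unfolding does_PR_def cinner_diff_left cinner_scaleC_left right_minus_eq by blast

lemma lin_indep_pair_iff:
  "lin_indep_pair x y \<longleftrightarrow> x \<noteq> 0 \<and> y \<notin> cspan {x}"
proof (cases "x = y")
  case True
  then show ?thesis
    by (simp add: lin_indep_pair_def complex_vector.span_base)
next
  case False
  then have "lin_indep_pair x y \<longleftrightarrow> \<not> cdependent (insert y {x})"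
    by (simp add: lin_indep_pair_def insert_commute)
  then show ?thesis
    using False by (auto simp: complex_vector.independent_insert complex_vector.dependent_single)
qed

lemma lin_indep_pair_comb_nonzero:
  assumes "lin_indep_pair x y" and "a \<noteq> 0 \<or> b \<noteq> 0"
  shows "a *\<^sub>C x + b *\<^sub>C y \<noteq> 0"
proof
  assume eq: "a *\<^sub>C x + b *\<^sub>C y = 0"
  show False
  proof (cases "b = 0")
    case True
    then show False
      using assms eq by (auto simp: lin_indep_pair_iff)
  next
    case False
    from eq have "b *\<^sub>C y = (- a) *\<^sub>C x"
      by (simp add: eq_neg_iff_add_eq_0 add.commute)
    then have "inverse b *\<^sub>C b *\<^sub>C y = inverse b *\<^sub>C (- a) *\<^sub>C x"
      by simp
    then have "y = (inverse b * (- a)) *\<^sub>C x"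
      using False by (simp add: scaleC_scaleC scaleC_one)
    then have "y \<in> cspan {x}"
      unfolding complex_vector.span_singleton by (rule range_eqI)
    then show False
      using assms by (simp add: lin_indep_pair_iff)
  qed
qed

lemma cspan_pair: "cspan {x, y} = {a *\<^sub>C x + b *\<^sub>C y | a b. True}"
proof (intro set_eqI)
  fix z
  have "z \<in> cspan {x, y} \<longleftrightarrow> (\<exists>a b. z - a *\<^sub>C x = b *\<^sub>C y)"
    unfolding complex_vector.span_insert[of x] complex_vector.span_singleton by blast
  then show "z \<in> cspan {x, y} \<longleftrightarrow> z \<in> {a *\<^sub>C x + b *\<^sub>C y | a b. True}"
    by (simp add: diff_eq_eq add.commute)
qed

text \<open>If \<open>x\<close> spanned the space, \<open>{x}\<close> would be a finite spanning set
  and the dimension at most 1. So some vector lies off the line of \<open>x\<close>.\<close>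

lemma lin_indep_pair_exists:
  fixes x :: "'a::complex_vector"
  assumes "cdim_at_least 2 TYPE('a)" and "x \<noteq> 0"
  obtains y where "lin_indep_pair x y"
proof (cases "cspan {x} = UNIV")
  case True
  then have "2 \<le> cdim (UNIV :: 'a set)"
    using assms(1) unfolding cdim_at_least_def by blast
  moreover have "cdim (UNIV :: 'a set) \<le> card {x}"
    by (rule complex_vector.dim_le_card) (auto simp: True)
  ultimately show ?thesis by simp
next
  case False
  then show ?thesis using that assms(2) by (auto simp: lin_indep_pair_iff)
qed

text \<open>Lagrange interpolation with cleared denominators:
  \<open>f - \<theta> *\<^sub>C h\<close> is affine in \<theta>, so its values at
  \<open>\<theta>1\<close> and \<open>\<theta>2\<close> determine the one at
  \<open>\<theta>3\<close>.\<close>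

lemma collinear_combination:
  "(\<theta>2 - \<theta>1) *\<^sub>C (f - \<theta>3 *\<^sub>C h) =
    (\<theta>2 - \<theta>3) *\<^sub>C (f - \<theta>1 *\<^sub>C h) + (\<theta>3 - \<theta>1) *\<^sub>C (f - \<theta>2 *\<^sub>C h)"
proof -
  have "(\<theta>2 - \<theta>1) * \<theta>3 = (\<theta>2 - \<theta>3) * \<theta>1 + (\<theta>3 - \<theta>1) * \<theta>2"
    by (simp add: algebra_simps)
  then have "((\<theta>2 - \<theta>1) * \<theta>3) *\<^sub>C h = ((\<theta>2 - \<theta>3) * \<theta>1) *\<^sub>C h + ((\<theta>3 - \<theta>1) * \<theta>2) *\<^sub>C h"
    by (simp only: scaleC_add_left)
  then show ?thesis
    by (simp add: complex_vector.scale_right_diff_distrib scaleC_scaleC)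
      (simp add: complex_vector.scale_left_diff_distrib)
qed

lemma not_does_PR_of_nonzero_combination:
  fixes G :: "'a::complex_inner set"
  assumes dist: "\<theta>1 \<noteq> \<theta>2" "\<theta>1 \<noteq> \<theta>3" "\<theta>2 \<noteq> \<theta>3"
    and nz: "x1 \<noteq> 0" "x2 \<noteq> 0" "a *\<^sub>C x1 + b *\<^sub>C x2 \<noteq> 0" "a \<noteq> 0" "b \<noteq> 0"
    and orth: "\<And>g. g \<in> G \<Longrightarrow>
      cinner x1 g = 0 \<or> cinner x2 g = 0 \<or> cinner (a *\<^sub>C x1 + b *\<^sub>C x2) g = 0"
  shows "\<not> does_PR {\<theta>1, \<theta>2, \<theta>3} G"
proof -
  \<comment> \<open>These scalars cancel the coefficients in \<open>collinear_combination\<close>.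
    They are nonzero, so \<open>y1\<close> and \<open>y2\<close> are orthogonal to the same vectors
    as \<open>x1\<close> and \<open>x2\<close>.\<close>
  define y1 where "y1 = (a / (\<theta>2 - \<theta>3)) *\<^sub>C x1"
  define y2 where "y2 = (b / (\<theta>3 - \<theta>1)) *\<^sub>C x2"
  \<comment> \<open>Solution of the system \<open>f - \<theta>1 *\<^sub>C h = y1\<close>,
    \<open>f - \<theta>2 *\<^sub>C h = y2\<close>; subtracting the equations gives
    \<open>h\<close>.\<close>
  define h where "h = inverse (\<theta>2 - \<theta>1) *\<^sub>C (y1 - y2)"
  define f where "f = y1 + \<theta>1 *\<^sub>C h"
  have f1: "f - \<theta>1 *\<^sub>C h = y1"
    by (simp add: f_def)
  have "(\<theta>2 - \<theta>1) *\<^sub>C h = y1 - y2"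
    using dist by (simp add: h_def scaleC_scaleC scaleC_one)
  then have f2: "f - \<theta>2 *\<^sub>C h = y2"
    unfolding f_def complex_vector.scale_left_diff_distrib
    by (metis add_diff_eq diff_diff_eq2 add_diff_cancel_left')
  have f3: "(\<theta>2 - \<theta>1) *\<^sub>C (f - \<theta>3 *\<^sub>C h) = a *\<^sub>C x1 + b *\<^sub>C x2"
    using dist collinear_combination[of \<theta>2 \<theta>1 f \<theta>3 h]
    by (simp add: f1 f2 y1_def y2_def scaleC_scaleC)
  have "y1 \<noteq> 0" "y2 \<noteq> 0"
    using nz dist by (simp_all add: y1_def y2_def)
  moreover have "f - \<theta>3 *\<^sub>C h \<noteq> 0"
    using f3 nz(3) by (metis complex_vector.scale_zero_right)
  ultimately have "\<forall>\<theta>\<in>{\<theta>1, \<theta>2, \<theta>3}. f - \<theta> *\<^sub>C h \<noteq> 0"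
    by (simp only: ball_simps f1 f2) simp
  moreover have "cinner (f - \<theta>3 *\<^sub>C h) g = 0" if "cinner (a *\<^sub>C x1 + b *\<^sub>C x2) g = 0" for g
    using that dist unfolding f3[symmetric] cinner_scaleC_left by simp
  then have "\<exists>\<theta>\<in>{\<theta>1, \<theta>2, \<theta>3}. cinner (f - \<theta> *\<^sub>C h) g = 0" if "g \<in> G" for g
    using orth[OF that] by (auto simp: f1 f2 y1_def y2_def cinner_scaleC_left)
  ultimately show ?thesis
    unfolding not_does_PR_iff by blast
qed

theorem corollary3p1:
  fixes G :: "'a::complex_hilbert_space set"
    and \<theta>1 \<theta>2 \<theta>3 :: complex
    and \<Theta> :: "complex set"
  assumes "cdim_at_least 2 TYPE('a)"
    and "G \<noteq> {}"
    and "\<Theta> = {\<theta>1, \<theta>2, \<theta>3}"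
    and "\<Theta> \<subseteq> {z. cmod z = 1}"
    and "\<theta>1 \<noteq> \<theta>2" and "\<theta>1 \<noteq> \<theta>3" and "\<theta>2 \<noteq> \<theta>3"
  shows "\<not> does_PR \<Theta> G \<longleftrightarrow>
    (\<exists>G1 G2 G3 x1 x2 x3.
       G1 \<subseteq> G \<and> G2 \<subseteq> G \<and> G3 \<subseteq> G \<and> G1 \<union> G2 \<union> G3 = G \<and>
       x1 \<noteq> 0 \<and> x1 \<in> orth_compl G1 \<and>
       x2 \<noteq> 0 \<and> x2 \<in> orth_compl G2 \<and>
       x3 \<noteq> 0 \<and> x3 \<in> orth_compl G3 \<and>
       lin_indep_pair x1 x2 \<and>
       x3 \<in> cspan {x1, x2})" (is "_ \<longleftrightarrow> ?R")
proof
  assume "\<not> does_PR \<Theta> G"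
  then obtain f h where nz: "\<And>\<theta>. \<theta> \<in> \<Theta> \<Longrightarrow> f - \<theta> *\<^sub>C h \<noteq> 0"
    and orth: "\<And>g. g \<in> G \<Longrightarrow> \<exists>\<theta>\<in>\<Theta>. cinner (f - \<theta> *\<^sub>C h) g = 0"
    unfolding not_does_PR_iff by blast
  define y where "y = (\<lambda>\<theta>. f - \<theta> *\<^sub>C h)"
  \<comment> \<open>The largest subset of \<open>G\<close> that \<open>y \<theta>\<close> is
    orthogonal to.\<close>
  define A where "A = (\<lambda>\<theta>. {g \<in> G. cinner (y \<theta>) g = 0})"
  have ynz: "y \<theta>1 \<noteq> 0" "y \<theta>2 \<noteq> 0" "y \<theta>3 \<noteq> 0"
    using nz assms(3) by (auto simp: y_def)
  have A: "A \<theta> \<subseteq> G" "y \<theta> \<in> orth_compl (A \<theta>)" for \<theta>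
    by (auto simp: A_def orth_compl_def)
  have cover: "A \<theta>1 \<union> A \<theta>2 \<union> A \<theta>3 = G"
  proof
    show "G \<subseteq> A \<theta>1 \<union> A \<theta>2 \<union> A \<theta>3"
      using orth unfolding assms(3) A_def y_def by blast
  qed (auto simp: A_def)
  have "(\<theta>2 - \<theta>1) *\<^sub>C y \<theta>3 \<in> cspan {y \<theta>1, y \<theta>2}"
    using collinear_combination[of \<theta>2 \<theta>1 f \<theta>3 h] unfolding y_def cspan_pair by blast
  then have "inverse (\<theta>2 - \<theta>1) *\<^sub>C (\<theta>2 - \<theta>1) *\<^sub>C y \<theta>3 \<in> cspan {y \<theta>1, y \<theta>2}"
    by (rule complex_vector.span_scale)
  then have y3: "y \<theta>3 \<in> cspan {y \<theta>1, y \<theta>2}"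
    using assms(5) by (simp add: scaleC_scaleC scaleC_one)
  show ?R
  proof (cases "lin_indep_pair (y \<theta>1) (y \<theta>2)")
    case True
    then show ?thesis
      using ynz A cover y3 by (intro exI conjI) assumption+
  next
    case False
    then have y2: "y \<theta>2 \<in> cspan {y \<theta>1}"
      using ynz by (simp add: lin_indep_pair_iff)
    then have "y \<theta>3 \<in> cspan {y \<theta>1}"
      using y3 complex_vector.span_redundant[OF y2] by (simp add: insert_commute)
    then obtain c d where "y \<theta>2 = c *\<^sub>C y \<theta>1" "y \<theta>3 = d *\<^sub>C y \<theta>1"
      using y2 by (auto simp: complex_vector.span_singleton)
    \<comment> \<open>Both \<open>c\<close> and \<open>d\<close> are nonzero because
      \<open>y \<theta>2\<close> and \<open>y \<theta>3\<close> are, so orthogonality passes back to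
      \<open>y \<theta>1\<close>.\<close>
    then have "A \<theta>2 \<subseteq> A \<theta>1" "A \<theta>3 \<subseteq> A \<theta>1"
      using ynz by (auto simp: A_def cinner_scaleC_left)
    then have "A \<theta>1 = G"
      using cover by blast
    then have G: "y \<theta>1 \<in> orth_compl G"
      using A(2) by blast
    obtain z where z: "lin_indep_pair (y \<theta>1) z"
      using lin_indep_pair_exists[OF assms(1) ynz(1)] .
    then have "z \<noteq> 0"
      by (auto simp: lin_indep_pair_iff complex_vector.span_zero)
    moreover have "y \<theta>1 \<in> cspan {y \<theta>1, z}"
      by (simp add: complex_vector.span_base)
    \<comment> \<open>Both \<open>x1\<close> and \<open>x3\<close> are \<open>y \<theta>1\<close>,
      orthogonal to all of \<open>G\<close>; \<open>G2\<close> is empty and puts no condition on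
      \<open>x2 = z\<close>.\<close>
    ultimately show ?thesis
      using G z ynz(1)
      by (intro exI[of _ G] exI[of _ "{}"] exI[of _ "y \<theta>1"] exI[of _ z] conjI)
        (simp_all add: orth_compl_def)
  qed
next
  assume ?R
  then obtain G1 G2 G3 x1 x2 x3 where cover: "G1 \<union> G2 \<union> G3 = G"
    and o1: "x1 \<in> orth_compl G1" and o2: "x2 \<in> orth_compl G2"
    and x3: "x3 \<noteq> 0" and o3: "x3 \<in> orth_compl G3"
    and ind: "lin_indep_pair x1 x2" and span: "x3 \<in> cspan {x1, x2}"
    by blast
  from span obtain a b where ab: "x3 = a *\<^sub>C x1 + b *\<^sub>C x2"
    by (auto simp: cspan_pair)
  have nz: "x1 \<noteq> 0" "x2 \<noteq> 0"
    using lin_indep_pair_comb_nonzero[OF ind, of 1 0] lin_indep_pair_comb_nonzero[OF ind, of 0 1]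
    by (auto simp: scaleC_one)
  have orth: "cinner x1 g = 0 \<or> cinner x2 g = 0 \<or> cinner x3 g = 0" if "g \<in> G" for g
    using that o1 o2 o3 cover by (auto simp: orth_compl_def)
  obtain a' b' where "a' \<noteq> 0" "b' \<noteq> 0"
    and "\<And>g. g \<in> G \<Longrightarrow>
      cinner x1 g = 0 \<or> cinner x2 g = 0 \<or> cinner (a' *\<^sub>C x1 + b' *\<^sub>C x2) g = 0"
  proof (cases "a = 0 \<or> b = 0")
    case True
    \<comment> \<open>Here \<open>x3\<close> is a nonzero multiple of \<open>x1\<close> or
      \<open>x2\<close>, so the first two alternatives already exhaust \<open>G\<close> and any
      nonzero coefficients will do.\<close>
    then have "cinner x1 g = 0 \<or> cinner x2 g = 0" if "g \<in> G" for g
      using orth[OF that] x3 by (auto simp: ab cinner_scaleC_left)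
    then show ?thesis
      using that[of 1 1] by auto
  next
    case False
    then show ?thesis
      using that[of a b] orth by (auto simp: ab)
  qed
  \<comment> \<open>Independence of \<open>x1\<close> and \<open>x2\<close> keeps the new
    combination nonzero.\<close>
  then show "\<not> does_PR \<Theta> G"
    unfolding assms(3) using assms(5-7) nz lin_indep_pair_comb_nonzero[OF ind]
    by (intro not_does_PR_of_nonzero_combination[where ?x1.0 = x1 and ?x2.0 = x2 and a = a' and b = b']) auto
qed

end
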